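(* Let $n\ge 1$, and let $m=(m_1,\dots,m_n)$ and $m'=(m'_1,\dots,m'_n)$ be integer $n$-tuples with $m_1>m_2>\cdots>m_n>0$ and $m'_1>m'_2>\cdots>m'_n>0$. Then $$2^{2n}\int_{\overline F}\cos^-_m(x)\,\cos^-_{m'}(x)\,dx=\delta_{m,m'} .$$
   Context: $\cos^-_m(x):=\det\big(\cos 2\pi m_ix_j\big)_{i,j=1}^n$ for $x=(x_1,\dots,x_n)\in\mathbb R^n$. $\overline F=\{x\in\mathbb R^n:\ \tfrac12\ge x_1\ge x_2\ge\cdots\ge x_n\ge 0\}$, and $dx$ is Lebesgue (Euclidean) measure. *)

theory Defs
  imports "HOL-Analysis.Analysis"
begin

text \<open>
  Coordinates are indexed by an arbitrary finite linearly ordered type \<open>'n\<close> with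
  \<open>n = CARD('n) \<ge> 1\<close>: its least element plays the role of the index 1 and its greatest
  element that of the index \<open>n\<close>.
\<close>

definition cos_minus :: "int ^ 'n \<Rightarrow> real ^ 'n \<Rightarrow> real" where
  "cos_minus m x = det (\<chi> i j. cos (2 * pi * of_int (m $ i) * x $ j))"

definition Fbar :: "(real ^ 'n::{finite,linorder}) set" where
  "Fbar = {x. (\<forall>i. 0 \<le> x $ i \<and> x $ i \<le> 1 / 2) \<and> (\<forall>i j. i < j \<longrightarrow> x $ i \<ge> x $ j)}"

definition strictly_dominant :: "int ^ 'n::{finite,linorder} \<Rightarrow> bool" where
  "strictly_dominant m \<longleftrightarrow> (\<forall>i j. i < j \<longrightarrow> m $ i > m $ j) \<and> (\<forall>i. m $ i > 0)"

end

theory Submission imports Defs begin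

text \<open>
  The product of the two alternating functions is invariant under permuting coordinates, and up
  to a null set the cube \<open>[0, 1/2]\<^sup>n\<close> splits into the \<open>n!\<close> permuted copies of the chamber.
  So the integral over the chamber is \<open>1/n!\<close> times that over the cube. There, expanding both
  determinants reduces everything to the one-dimensional orthogonality of cosines: the term for
  \<open>(p, q)\<close> survives iff \<open>m \<circ> p = m' \<circ> q\<close>, which for strictly decreasing tuples
  forces \<open>m = m'\<close> and \<open>p = q\<close>.
\<close>

section \<open>Ranks and sorting permutations of a finite linear order\<close>

lemma bij_betw_rank:
  fixes f :: "'n::finite \<Rightarrow> 'b::linorder"
  assumes "inj f"
  shows "bij_betw (\<lambda>i. card {j. f j < f i}) UNIV {..<CARD('n)}"
proof -
  \<comment> \<open>The index \<open>a\<close> itself makes the inclusion of the two sets strict. So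
    ranks separate points, and an injection into \<open>{..<CARD('n)}\<close> from a set of that
    size is onto.\<close>
  have mono: "card {j. f j < f a} < card {j. f j < f b}" if "f a < f b" for a b
    by (rule psubset_card_mono) (use that in \<open>auto intro: less_trans\<close>)
  have "inj (\<lambda>i. card {j. f j < f i})"
    by (rule injI) (metis mono assms injD less_irrefl linorder_neqE)
  moreover have "card {j. f j < f i} < CARD('n)" for i
    by (rule psubset_card_mono) auto
  ultimately show ?thesis
    by (intro bij_betw_imageI card_subset_eq) (auto simp: card_image)
qed

text \<open>Such a \<open>p\<close> carries the elements below \<open>i\<close> exactly onto the
  elements below \<open>p i\<close>, so \<open>i\<close> and \<open>p i\<close> have equal rank and
  coincide.\<close>

lemma permutes_strict_mono_eq_id:
  fixes p :: "'n::{finite,linorder} \<Rightarrow> 'n"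
  assumes "p permutes UNIV" "strict_mono p"
  shows "p = id"
proof
  fix i
  have "{j. j < p i} = p ` {j. j < i}"
    using permutes_bij[OF assms(1)] assms(2)
    by (auto simp: strict_mono_less image_iff) (metis bij_pointE strict_mono_less)
  then have "card {j. j < p i} = card {j. j < i}"
    using permutes_inj[OF assms(1)] by (simp add: card_image inj_on_def)
  then show "p i = id i"
    using bij_betw_rank[of "id :: 'n \<Rightarrow> 'n"] by (auto simp: bij_betw_def dest: injD)
qed

text \<open>With \<open>r = p \<circ> inv q\<close> one gets \<open>y = x \<circ> r\<close>. As both
  tuples decrease strictly, \<open>r\<close> increases strictly and is the identity. This serves
  twice: for the disjointness of the permuted chambers, and for deciding which determinant terms
  survive.\<close>

lemma strict_antimono_permutes_unique:
  fixes x y :: "'n::{finite,linorder} \<Rightarrow> 'b::linorder"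
  assumes p: "p permutes UNIV" and q: "q permutes UNIV"
    and x: "\<And>i j. i < j \<Longrightarrow> x i > x j" and y: "\<And>i j. i < j \<Longrightarrow> y i > y j"
    and eq: "x \<circ> p = y \<circ> q"
  shows "p = q"
proof -
  define r where "r = p \<circ> inv q"
  have r: "r permutes UNIV"
    unfolding r_def by (intro permutes_compose permutes_inv p q)
  have y_r: "y i = x (r i)" for i
    using fun_cong[OF eq, of "inv q i"] permutes_inverses[OF q] by (simp add: r_def)
  have "strict_mono r"
    by (rule strict_monoI) (metis y_r x y less_asym linorder_neqE)
  then have "p \<circ> inv q = id"
    using permutes_strict_mono_eq_id[OF r] by (simp add: r_def)
  then have "p (inv q (q i)) = q i" for i
    by (metis comp_apply id_apply)
  then show ?thesis
    using permutes_inverses[OF q] by (simp add: fun_eq_iff)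
qed

lemma ex_antimono_permutation:
  fixes x :: "'n::{finite,linorder} \<Rightarrow> real"
  assumes "inj x"
  obtains p where "p permutes UNIV" "\<And>i j. i < j \<Longrightarrow> x (p i) > x (p j)"
proof -
  define r where "r = (\<lambda>i::'n. card {j. j < i})"
  \<comment> \<open>The negation gives the largest value rank 0, so that matching ranks sorts in
    decreasing order.\<close>
  define s where "s = (\<lambda>i. card {j. - x j < - x i})"
  have r: "bij_betw r UNIV {..<CARD('n)}"
    using bij_betw_rank[of "id :: 'n \<Rightarrow> 'n"] by (simp add: r_def)
  have s: "bij_betw s UNIV {..<CARD('n)}"
    unfolding s_def using assms by (intro bij_betw_rank) (simp add: inj_on_def)
  define p where "p = inv_into UNIV s \<circ> r"
  have "bij p"
    unfolding p_def by (rule bij_betw_trans[OF r bij_betw_inv_into[OF s]])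
  then have "p permutes UNIV"
    by (auto intro: bij_imp_permutes)
  moreover have "x (p i) > x (p j)" if "i < j" for i j
  proof (rule ccontr)
    assume "\<not> x (p j) < x (p i)"
    then have "s (p j) \<le> s (p i)"
      unfolding s_def by (intro card_mono) auto
    moreover have "s (p k) = r k" for k
      unfolding p_def comp_def using r s
      by (intro f_inv_into_f) (auto simp: bij_betw_def)
    moreover have "r i < r j"
      unfolding r_def by (rule psubset_card_mono) (use that in \<open>auto intro: less_trans\<close>)
    ultimately show False by simp
  qed
  ultimately show thesis by (rule that)
qed

section \<open>Lebesgue measure in coordinates\<close>

lemma prod_Basis_cart:
  "(\<Prod>b\<in>(Basis :: (real ^ 'n::finite) set). f b) = (\<Prod>i\<in>UNIV. f (axis i 1))"
proof -
  have Basis: "(Basis :: (real ^ 'n) set) = (\<lambda>i. axis i 1) ` UNIV"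
    by (auto simp: Basis_vec_def)
  show ?thesis
    unfolding Basis by (subst prod.reindex) (auto simp: inj_on_def axis_eq_axis)
qed

lemma measurable_permute_coords [measurable]:
  "(\<lambda>x::real ^ 'n::finite. \<chi> i. x $ p i) \<in> borel_measurable borel"
  by (intro borel_measurable_continuous_onI continuous_intros)

text \<open>Lebesgue measure is determined by its values on boxes. The preimage of a box is the box
  with bounds permuted by \<open>inv p\<close>, whose side lengths are the same up to order.\<close>

lemma distr_lborel_permute_coords:
  assumes p: "p permutes (UNIV :: 'n::finite set)"
  shows "distr lborel borel (\<lambda>x::real ^ 'n. \<chi> i. x $ p i) = lborel"
proof (rule lborel_eqI[symmetric])
  fix l u :: "real ^ 'n"
  assume "\<And>b. b \<in> Basis \<Longrightarrow> l \<bullet> b \<le> u \<bullet> b"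
  then have le: "l $ i \<le> u $ i" for i
    by (metis axis_in_Basis_iff cart_eq_inner_axis insertI1 Basis_real_def)
  let ?v = "\<lambda>w :: real ^ 'n. \<chi> i. w $ inv p i"
  have inv: "p (inv p i) = i" "inv p (p i) = i" for i
    using permutes_inverses[OF p] by auto
  have vim: "(\<lambda>x::real ^ 'n. \<chi> i. x $ p i) -` box l u = box (?v l) (?v u)"
    by (auto simp: mem_box_cart) (metis inv)+
  have "emeasure (distr lborel borel (\<lambda>x::real ^ 'n. \<chi> i. x $ p i)) (box l u)
      = emeasure lborel (box (?v l) (?v u))"
    by (subst emeasure_distr) (simp_all add: vim)
  also have "\<dots> = (\<Prod>b\<in>Basis. (?v u - ?v l) \<bullet> b)"
    by (rule emeasure_lborel_box) (auto simp: Basis_vec_def inner_axis le)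
  also have "(\<Prod>b\<in>Basis. (?v u - ?v l) \<bullet> b) = (\<Prod>i\<in>UNIV. (u - l) $ inv p i)"
    unfolding prod_Basis_cart by (simp add: inner_axis)
  also have "\<dots> = (\<Prod>i\<in>UNIV. (u - l) $ i)"
    by (rule prod.reindex_bij_betw[OF permutes_bij[OF permutes_inv[OF p]]])
  also have "\<dots> = (\<Prod>b\<in>Basis. (u - l) \<bullet> b)"
    unfolding prod_Basis_cart by (simp add: inner_axis)
  finally show "emeasure (distr lborel borel (\<lambda>x::real ^ 'n. \<chi> i. x $ p i)) (box l u)
      = (\<Prod>b\<in>Basis. (u - l) \<bullet> b)" .
qed simp

lemma lborel_integral_prod_coords:
  fixes f :: "'n::finite \<Rightarrow> real \<Rightarrow> real"
  assumes "\<And>i. integrable lborel (f i)"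
  shows "(LINT x|lborel. (\<Prod>i\<in>UNIV. f i (x $ i))) = (\<Prod>i\<in>UNIV. integral\<^sup>L lborel (f i))"
proof -
  interpret product_sigma_finite "\<lambda>_. lborel :: real measure" ..
  let ?B = "Basis :: (real ^ 'n) set"
  \<comment> \<open>\<open>lborel\<close> is the image of a product measure indexed by basis
    vectors, so the family \<open>f\<close> is reindexed along the inverse of \<open>axis\<close>;
    Fubini for products then applies.\<close>
  let ?g = "\<lambda>b::real ^ 'n. f (THE i. b = axis i 1)"
  have g: "?g (axis i 1) = f i" for i
    by (simp add: axis_eq_axis)
  have [measurable]: "f i \<in> borel_measurable borel" for i
    using borel_measurable_integrable[OF assms[of i]] by simp
  have meas: "(\<lambda>x. \<Prod>i\<in>UNIV. f i (x $ i)) \<in> borel_measurable borel"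
    by measurable
  have "(LINT x|lborel. (\<Prod>i\<in>UNIV. f i (x $ i)))
      = (LINT y|(\<Pi>\<^sub>M b\<in>?B. lborel). (\<Prod>i\<in>UNIV. f i ((\<Sum>b\<in>?B. y b *\<^sub>R b) $ i)))"
    by (subst lborel_eq, subst integral_distr) (use meas in simp_all)
  also have "\<dots> = (LINT y|(\<Pi>\<^sub>M b\<in>?B. lborel). (\<Prod>b\<in>?B. ?g b (y b)))"
    unfolding prod_Basis_cart g by (simp add: cart_eq_inner_axis inner_sum_left inner_Basis if_distrib cong: if_cong)
  also have "\<dots> = (\<Prod>b\<in>?B. integral\<^sup>L lborel (?g b))"
    by (rule product_integral_prod) (auto simp: assms)
  also have "\<dots> = (\<Prod>i\<in>UNIV. integral\<^sup>L lborel (f i))"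
    unfolding prod_Basis_cart g ..
  finally show ?thesis .
qed

text \<open>The exceptional points lie on finitely many hyperplanes, each of measure zero. These
  contain the walls that different permuted chambers share.\<close>

lemma AE_lborel_inj_coords: "AE x in lborel. inj (\<lambda>i. (x :: real ^ 'n::finite) $ i)"
proof -
  have "AE x in lborel. (x :: real ^ 'n) $ i \<noteq> x $ j" if "i \<noteq> j" for i j
  proof -
    let ?H = "{x :: real ^ 'n. (axis i 1 - axis j 1) \<bullet> x = 0}"
    have "negligible ?H"
      using that by (intro negligible_hyperplane) (simp add: axis_eq_axis)
    moreover have "?H \<in> sets lborel"
      by (simp add: borel_closed closed_hyperplane)
    ultimately have "?H \<in> null_sets lborel"
      using negligible_iff_null_sets null_sets_completion_iff by blast
    then show ?thesis
      by (rule AE_I') (auto simp: inner_diff_left inner_axis')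
  qed
  then have "AE x in lborel. \<forall>i j. i \<noteq> j \<longrightarrow> (x :: real ^ 'n) $ i \<noteq> x $ j"
    by (intro AE_all_countable[THEN iffD2] allI) auto
  then show ?thesis
    by eventually_elim (auto simp: inj_on_def)
qed

section \<open>Orthogonality of cosines in one variable\<close>

lemma lborel_integral_cos_half_period:
  fixes k :: int
  shows "(LINT t|lborel. indicator {0..1/2} t * cos (2 * pi * k * t)) = (if k = 0 then 1/2 else (0::real))"
proof (cases "k = 0")
  case False
  let ?F = "\<lambda>t. sin (2 * pi * k * t) / (2 * pi * k)"
  have "(LINT t|lborel. indicator {0..1/2} t *\<^sub>R cos (2 * pi * k * t)) = ?F (1/2) - ?F 0"
    using False
    by (intro integral_FTC_atLeastAtMost)
      (auto intro!: derivative_eq_intros continuous_intros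
        simp: has_real_derivative_iff_has_vector_derivative[symmetric])
  \<comment> \<open>At \<open>t = 1/2\<close> the argument of the sine is \<open>pi * k\<close>, an
    integer multiple of \<open>pi\<close>.\<close>
  also have "\<dots> = 0"
    using sin_int_times_real[of k 1] by (simp add: sin_zero_iff_int2)
  finally show ?thesis using False by simp
qed simp

text \<open>The indicator is part of the factor so that an integral over the cube becomes a product
  of integrals over the whole line.\<close>

definition cos_pair :: "int \<Rightarrow> int \<Rightarrow> real \<Rightarrow> real" where
  "cos_pair a b t = indicator {0..1/2} t * (cos (2 * pi * a * t) * cos (2 * pi * b * t))"

lemma integrable_cos_pair: "integrable lborel (cos_pair a b)"
proof -
  have "integrable lborel (\<lambda>t. indicator {0..1/2} t *\<^sub>R (cos (2 * pi * a * t) * cos (2 * pi * b * t)))"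
    by (intro borel_integrable_compact continuous_intros) auto
  then show ?thesis
    by (simp add: cos_pair_def[abs_def])
qed

text \<open>The product is half the sum of the cosines with frequencies \<open>a - b\<close> and
  \<open>a + b\<close>. Positivity keeps \<open>a + b\<close> nonzero, so only \<open>a = b\<close>
  contributes, giving half of 1/2.\<close>

lemma integral_cos_pair:
  assumes "a > 0" "b > 0"
  shows "integral\<^sup>L lborel (cos_pair a b) = (if a = b then 1/4 else 0)"
proof -
  let ?c = "\<lambda>k::int. \<lambda>t::real. indicator {0..1/2} t * cos (2 * pi * k * t)"
  have int: "integrable lborel (?c k)" for k
    using borel_integrable_compact[of "{0..1/2::real}" "\<lambda>t. cos (2 * pi * k * t)"]
    by (simp add: continuous_intros)
  have "cos_pair a b = (\<lambda>t. (?c (a - b) t + ?c (a + b) t) / 2)"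
    by (rule ext) (simp add: cos_pair_def cos_times_cos algebra_simps)
  then have "integral\<^sup>L lborel (cos_pair a b) = (integral\<^sup>L lborel (?c (a - b)) + integral\<^sup>L lborel (?c (a + b))) / 2"
    by (simp only: integral_divide_zero Bochner_Integration.integral_add[OF int int])
  then show ?thesis
    using assms by (simp only: lborel_integral_cos_half_period) auto
qed

section \<open>The cube, the chamber and coordinate permutations\<close>

definition half_cube :: "(real ^ 'n::finite) set" where
  "half_cube = {x. \<forall>i. 0 \<le> x $ i \<and> x $ i \<le> 1/2}"

lemma half_cube_eq_cbox: "half_cube = cbox 0 (\<chi> i. 1/2)"
  by (auto simp: half_cube_def mem_box_cart)

lemma continuous_on_cos_minus [continuous_intros]: "continuous_on S (cos_minus m)"
  unfolding cos_minus_def[abs_def] det_def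
  by (auto intro!: continuous_intros)

lemma cos_minus_permute_coords:
  assumes "p permutes UNIV"
  shows "cos_minus m (\<chi> i. x $ p i) = of_int (sign p) * cos_minus m x"
  using det_permute_columns[OF assms, of "\<chi> i j. cos (2 * pi * of_int (m $ i) * x $ j)"]
  by (simp add: cos_minus_def)

text \<open>Transposing first lets the permutation act on \<open>m\<close> instead of
  \<open>x\<close>. Each coordinate \<open>x $ i\<close> then occurs in factor \<open>i\<close>
  only, so two expansions can be multiplied coordinate by coordinate.\<close>

lemma cos_minus_expand:
  "cos_minus m x = (\<Sum>p | p permutes UNIV. of_int (sign p) * (\<Prod>i\<in>UNIV. cos (2 * pi * of_int (m $ p i) * x $ i)))"
proof -
  have "cos_minus m x = det (transpose (\<chi> i j. cos (2 * pi * of_int (m $ i) * x $ j)))"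
    unfolding cos_minus_def det_transpose ..
  then show ?thesis
    by (simp add: det_def transpose_def)
qed

lemma compact_Fbar: "compact (Fbar :: (real ^ 'n::{finite,linorder}) set)"
proof -
  have "Fbar = half_cube \<inter> (\<Inter>i. \<Inter>j\<in>{j. i < j}. {x :: (real, 'n) vec. x $ j \<le> x $ i})"
    by (auto simp: Fbar_def half_cube_def)
  also have "compact \<dots>"
    unfolding half_cube_eq_cbox
    by (intro compact_Int_closed compact_cbox closed_INT ballI closed_Collect_le continuous_intros)
  finally show ?thesis .
qed

text \<open>Exactly one permutation sorts distinct coordinates into decreasing order, so exactly one
  summand can be nonzero; it is 1 iff the point lies in the cube, which is invariant under
  permutations.\<close>

lemma indicator_half_cube_eq_sum:
  fixes x :: "real ^ 'n::{finite,linorder}"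
  assumes "inj (\<lambda>i. x $ i)"
  shows "(\<Sum>p | p permutes UNIV. indicator Fbar (\<chi> i. x $ p i)) = (indicator half_cube x :: real)"
proof -
  obtain p where p: "p permutes UNIV" "\<And>i j. i < j \<Longrightarrow> x $ p i > x $ p j"
    using ex_antimono_permutation[OF assms] by blast
  have cube: "(\<forall>i. 0 \<le> x $ q i \<and> x $ q i \<le> 1/2) \<longleftrightarrow> x \<in> half_cube" if "q permutes UNIV" for q
  proof -
    have "x $ i = x $ q (inv q i)" for i
      by (simp add: permutes_inverses(1)[OF that])
    then show ?thesis
      unfolding half_cube_def mem_Collect_eq by metis
  qed
  have "indicator Fbar (\<chi> i. x $ q i) = (if q = p then indicator half_cube x else 0 :: real)"
    if q: "q permutes UNIV" for q
  proof (cases "q = p")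
    case True
    then show ?thesis
      using p(2) cube[OF p(1)] by (auto simp: Fbar_def less_imp_le split: split_indicator)
  next
    case False
    have "(\<chi> i. x $ q i) \<notin> Fbar"
    proof
      assume "(\<chi> i. x $ q i) \<in> Fbar"
      then have "x $ q i \<ge> x $ q j" if "i < j" for i j
        using that by (simp add: Fbar_def)
      \<comment> \<open>\<open>Fbar\<close> allows ties; distinct coordinates exclude them.\<close>
      moreover have "x $ q i \<noteq> x $ q j" if "i < j" for i j
        using that injD[OF assms, of "q i" "q j"] injD[OF permutes_inj[OF q], of i j] by auto
      ultimately have "x $ q i > x $ q j" if "i < j" for i j
        using that by (metis order_less_le)
      \<comment> \<open>Composing the sorted tuples with \<open>inv p\<close> and
        \<open>inv q\<close> gives back \<open>x\<close> both times, which is the shape of equation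
        that the uniqueness lemma takes.\<close>
      then have "inv p = inv q"
        by (intro strict_antimono_permutes_unique[of _ _ "\<lambda>i. x $ p i" "\<lambda>i. x $ q i"] permutes_inv p q)
          (auto simp: fun_eq_iff permutes_inverses[OF p(1)] permutes_inverses[OF q])
      then show False
        using False p(1) q by (metis permutes_inv_inv)
    qed
    with False show ?thesis by simp
  qed
  then have "(\<Sum>p | p permutes UNIV. indicator Fbar (\<chi> i. x $ p i))
      = (\<Sum>q | q permutes UNIV. if q = p then indicator half_cube x else 0 :: real)"
    by (intro sum.cong) auto
  also have "\<dots> = indicator half_cube x"
    using p(1) by (simp add: finite_permutations)
  finally show ?thesis .
qed

text \<open>Permuting coordinates preserves both the measure and \<open>g\<close>, so each of the
  \<open>n!\<close> permuted chambers contributes the same integral.\<close>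

lemma integral_half_cube_eq_fact_times_integral_Fbar:
  fixes g :: "real ^ 'n::{finite,linorder} \<Rightarrow> real"
  assumes cont: "continuous_on UNIV g"
    and inv: "\<And>p x. p permutes UNIV \<Longrightarrow> g (\<chi> i. x $ p i) = g x"
  shows "(LINT x:half_cube|lborel. g x) = fact CARD('n) * (LINT x:Fbar|lborel. g x)"
proof -
  let ?h = "\<lambda>x. indicator Fbar x *\<^sub>R g x"
  have int: "integrable lborel ?h"
    by (rule borel_integrable_compact[OF compact_Fbar continuous_on_subset[OF cont]]) simp
  then have [measurable]: "?h \<in> borel_measurable borel"
    using borel_measurable_integrable by fastforce
  have int_p: "integrable lborel (\<lambda>x. ?h (\<chi> i. x $ p i))"
    and eq_p: "(LINT x|lborel. ?h (\<chi> i. x $ p i)) = integral\<^sup>L lborel ?h"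
    if "p permutes UNIV" for p
    using integrable_distr_eq[of "\<lambda>x. \<chi> i. x $ p i" lborel borel ?h]
      integral_distr[of "\<lambda>x. \<chi> i. x $ p i" lborel borel ?h] int
    by (simp_all add: distr_lborel_permute_coords[OF that])
  have "(LINT x:half_cube|lborel. g x)
      = (LINT x|lborel. (\<Sum>p | p permutes UNIV. ?h (\<chi> i. x $ p i)))"
    unfolding set_lebesgue_integral_def
  proof (rule integral_cong_AE)
    show "(\<lambda>x. indicator half_cube x *\<^sub>R g x) \<in> borel_measurable lborel"
      unfolding half_cube_eq_cbox
      by (intro borel_measurable_integrable borel_integrable_compact continuous_on_subset[OF cont]) auto
    show "(\<lambda>x. \<Sum>p | p permutes UNIV. ?h (\<chi> i. x $ p i)) \<in> borel_measurable lborel"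
      using int_p by (intro borel_measurable_sum borel_measurable_integrable) auto
    show "AE x in lborel. indicator half_cube x *\<^sub>R g x = (\<Sum>p | p permutes UNIV. ?h (\<chi> i. x $ p i))"
      using AE_lborel_inj_coords
    proof eventually_elim
      case (elim x)
      show ?case
        \<comment> \<open>Invariance turns every \<open>g\<close> of a permuted point into
          \<open>g x\<close>, which factors out of the sum of indicators.\<close>
        by (simp add: inv sum_distrib_right indicator_half_cube_eq_sum[OF elim, symmetric])
    qed
  qed
  also have "\<dots> = (\<Sum>p | p permutes UNIV. LINT x|lborel. ?h (\<chi> i. x $ p i))"
    by (intro Bochner_Integration.integral_sum int_p) simp
  also have "\<dots> = (\<Sum>p | p permutes (UNIV :: 'n set). integral\<^sup>L lborel ?h)"
    by (intro sum.cong refl eq_p) simp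
  also have "\<dots> = fact CARD('n) * integral\<^sup>L lborel ?h"
    by (simp add: card_permutations[OF refl])
  finally show ?thesis
    by (simp add: set_lebesgue_integral_def)
qed

section \<open>Orthogonality over the cube and over the chamber\<close>

lemma integral_half_cube_cos_minus:
  fixes m m' :: "int ^ 'n::{finite,linorder}"
  assumes "strictly_dominant m" and "strictly_dominant m'"
  shows "(LINT x:half_cube|lborel. cos_minus m x * cos_minus m' x)
    = (if m = m' then fact CARD('n) / 4 ^ CARD('n) else 0)"
proof -
  let ?P = "{p. p permutes (UNIV :: 'n set)}"
  let ?t = "\<lambda>p q (x :: (real, 'n) vec). \<Prod>i\<in>UNIV. cos_pair (m $ p i) (m' $ q i) (x $ i)"
  have dec: "\<And>i j. i < j \<Longrightarrow> m $ i > m $ j" "\<And>i j. i < j \<Longrightarrow> m' $ i > m' $ j"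
    and pos: "\<And>i. m $ i > 0" "\<And>i. m' $ i > 0"
    using assms by (auto simp: strictly_dominant_def)
  have ind: "indicator half_cube x = (\<Prod>i\<in>UNIV. indicator {0..1/2} (x $ i) :: real)" for x :: "(real, 'n) vec"
    by (auto simp: half_cube_def indicator_def)
  have expand: "indicator half_cube x *\<^sub>R (cos_minus m x * cos_minus m' x)
      = (\<Sum>p\<in>?P. \<Sum>q\<in>?P. of_int (sign p * sign q) * ?t p q x)" for x
    unfolding cos_minus_expand sum_product
    by (simp add: sum_distrib_left ind cos_pair_def prod.distrib mult_ac)
  \<comment> \<open>With the indicators collected, the term is a continuous function cut off to a
    compact box.\<close>
  have int: "integrable lborel (?t p q)" for p q
  proof -
    have "?t p q = (\<lambda>x. indicator half_cube x *\<^sub>R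
        (\<Prod>i\<in>UNIV. cos (2 * pi * of_int (m $ p i) * x $ i) * cos (2 * pi * of_int (m' $ q i) * x $ i)))"
      by (simp add: ind cos_pair_def prod.distrib fun_eq_iff)
    moreover have "integrable lborel \<dots>"
      unfolding half_cube_eq_cbox by (intro borel_integrable_compact continuous_intros compact_cbox)
    ultimately show ?thesis by simp
  qed
  have val: "integral\<^sup>L lborel (?t p q) = (if q = p then if m = m' then (1/4) ^ CARD('n) else 0 else 0)"
    if p: "p permutes UNIV" and q: "q permutes UNIV" for p q
  proof -
    have "integral\<^sup>L lborel (?t p q) = (\<Prod>i\<in>UNIV. if m $ p i = m' $ q i then 1/4 else 0)"
      by (subst lborel_integral_prod_coords[of "\<lambda>i. cos_pair (m $ p i) (m' $ q i)"])
        (simp_all add: integrable_cos_pair integral_cos_pair pos)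
    also have "\<dots> = (if \<forall>i. m $ p i = m' $ q i then (1/4) ^ CARD('n) else 0)"
      by (auto intro: prod_zero)
    \<comment> \<open>A single mismatched coordinate annihilates the product. If all match, two
      strictly decreasing tuples agree after rearrangement, which forces equal permutations and then
      equal tuples.\<close>
    also have "(\<forall>i. m $ p i = m' $ q i) \<longleftrightarrow> q = p \<and> m = m'"
    proof
      assume eq: "\<forall>i. m $ p i = m' $ q i"
      then have "p = q"
        by (intro strict_antimono_permutes_unique[OF p q, of "($) m" "($) m'"] dec) auto
      moreover have "m $ i = m' $ i" for i
        using eq[rule_format, of "inv p i"] \<open>p = q\<close> permutes_inverses[OF p] by simp
      ultimately show "q = p \<and> m = m'" by (simp add: vec_eq_iff)
    qed auto
    finally show ?thesis by auto
  qed
  have "(LINT x:half_cube|lborel. cos_minus m x * cos_minus m' x)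
      = (\<Sum>p\<in>?P. \<Sum>q\<in>?P. of_int (sign p * sign q) * integral\<^sup>L lborel (?t p q))"
    unfolding set_lebesgue_integral_def expand
    by (subst Bochner_Integration.integral_sum | simp add: int)+
  \<comment> \<open>Off the diagonal the integral vanishes; on it the two signs multiply to 1. What
    remains is \<open>n!\<close> equal terms.\<close>
  also have "\<dots> = (\<Sum>p\<in>?P. \<Sum>q\<in>?P. if q = p then if m = m' then (1/4) ^ CARD('n) else 0 else 0)"
    by (intro sum.cong refl) (auto simp: val sign_idempotent simp flip: of_int_mult)
  also have "\<dots> = (\<Sum>p\<in>?P. if m = m' then (1/4) ^ CARD('n) else 0)"
    by (intro sum.cong refl) (simp add: finite_permutations)
  also have "\<dots> = (if m = m' then fact CARD('n) / 4 ^ CARD('n) else 0)"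
    by (simp add: card_permutations[OF refl] power_one_over)
  finally show ?thesis .
qed

theorem mainTheorem2:
  fixes m m' :: "int ^ 'n::{finite,linorder}"
  assumes "strictly_dominant m" and "strictly_dominant m'"
  shows "2 ^ (2 * CARD('n)) * (LINT x:Fbar|lborel. cos_minus m x * cos_minus m' x)
           = (if m = m' then 1 else 0)"
proof -
  have "(LINT x:half_cube|lborel. cos_minus m x * cos_minus m' x)
      = fact CARD('n) * (LINT x:Fbar|lborel. cos_minus m x * cos_minus m' x)"
  proof (rule integral_half_cube_eq_fact_times_integral_Fbar)
    show "continuous_on UNIV (\<lambda>x. cos_minus m x * cos_minus m' x)"
      by (intro continuous_intros)
    show "cos_minus m (\<chi> i. x $ p i) * cos_minus m' (\<chi> i. x $ p i) = cos_minus m x * cos_minus m' x"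
      if "p permutes UNIV" for p and x :: "(real, 'n) vec"
      \<comment> \<open>Both factors acquire the same sign, and its square is 1.\<close>
      by (simp add: cos_minus_permute_coords[OF that] sign_def)
  qed
  then have "fact CARD('n) * (LINT x:Fbar|lborel. cos_minus m x * cos_minus m' x)
      = (if m = m' then fact CARD('n) / 4 ^ CARD('n) else 0)"
    using integral_half_cube_cos_minus[OF assms] by simp
  moreover have "(2 :: real) ^ (2 * CARD('n)) = 4 ^ CARD('n)"
    by (simp add: power_mult)
  ultimately show ?thesis
    \<comment> \<open>The nonzero factor \<open>fact CARD('n)\<close> cancels, and
      \<open>4 ^ CARD('n)\<close> offsets the factors 1/4 from the single coordinates.\<close>
    by (simp add: field_simps split: if_splits)
qed

end
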